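(* Let $n\ge 2$ be an integer. The matching number (maximum cardinality of a matching) of the zero-divisor graph $\Gamma(\mathbb{Z}_{2^n}[i])$ is $|V_{d_n}|+|V_{d_{n-1}}|-1$.
   Context: $\mathbb{Z}_{2^n}[i]=\{a+ib: a,b\in\mathbb{Z}_{2^n}\}\cong \mathbb{Z}[i]/\langle 2^n\rangle$ is the ring of Gaussian integers modulo $2^n$. For a commutative ring $R$, the zero-divisor graph $\Gamma(R)$ is the simple graph whose vertex set is the set $\mathcal{Z}(R)$ of nonzero zero-divisors of $R$, two distinct vertices $x,y$ being adjacent if and only if $xy=0$. For $1\le j\le 2n-1$ put $d_j=(1+i)^{2n-j}\in\mathbb{Z}_{2^n}[i]$ (these are the proper divisors of $2^n$ up to associates), and let $V_{d_j}=\{u d_j: u \text{ a unit of } \mathbb{Z}_{2^n}[i]\}$ be the associate class of $d_j$. *)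

theory Defs
  imports "HOL-Number_Theory.Residues"
begin

text \<open>The ring \<open>R[i] = {a + ib | a, b \<in> R}\<close> with \<open>i\<^sup>2 = -1\<close>; the pair \<open>(a, b)\<close>
  stands for \<open>a + ib\<close>.\<close>

definition gauss_ring :: "('a, 'b) ring_scheme \<Rightarrow> ('a \<times> 'a) ring" where
  "gauss_ring R =
    \<lparr>carrier = carrier R \<times> carrier R,
     monoid.mult = (\<lambda>(a, b) (c, d).
        ((a \<otimes>\<^bsub>R\<^esub> c) \<ominus>\<^bsub>R\<^esub> (b \<otimes>\<^bsub>R\<^esub> d), (a \<otimes>\<^bsub>R\<^esub> d) \<oplus>\<^bsub>R\<^esub> (b \<otimes>\<^bsub>R\<^esub> c))),
     one = (\<one>\<^bsub>R\<^esub>, \<zero>\<^bsub>R\<^esub>),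
     ring.zero = (\<zero>\<^bsub>R\<^esub>, \<zero>\<^bsub>R\<^esub>),
     add = (\<lambda>(a, b) (c, d). (a \<oplus>\<^bsub>R\<^esub> c, b \<oplus>\<^bsub>R\<^esub> d))\<rparr>"

definition imag_unit :: "('a, 'b) ring_scheme \<Rightarrow> 'a \<times> 'a" where
  "imag_unit R = (\<zero>\<^bsub>R\<^esub>, \<one>\<^bsub>R\<^esub>)"

definition gauss_int_mod :: "nat \<Rightarrow> (int \<times> int) ring" where
  "gauss_int_mod n = gauss_ring (residue_ring (2 ^ n))"

definition nonzero_zero_divisors :: "('a, 'b) ring_scheme \<Rightarrow> 'a set" where
  "nonzero_zero_divisors R =
    {x \<in> carrier R - {\<zero>\<^bsub>R\<^esub>}. \<exists>y \<in> carrier R - {\<zero>\<^bsub>R\<^esub>}. x \<otimes>\<^bsub>R\<^esub> y = \<zero>\<^bsub>R\<^esub>}"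

text \<open>A simple graph is a pair of a vertex set and a set of two-element sets of vertices.\<close>

type_synonym 'a graph = "'a set \<times> 'a set set"

definition zero_divisor_graph :: "('a, 'b) ring_scheme \<Rightarrow> 'a graph" where
  "zero_divisor_graph R =
    (nonzero_zero_divisors R,
     {{x, y} | x y. x \<in> nonzero_zero_divisors R \<and> y \<in> nonzero_zero_divisors R
        \<and> x \<noteq> y \<and> x \<otimes>\<^bsub>R\<^esub> y = \<zero>\<^bsub>R\<^esub>})"

definition matching :: "'a graph \<Rightarrow> 'a set set \<Rightarrow> bool" where
  "matching G M \<longleftrightarrow> M \<subseteq> snd G \<and> (\<forall>e \<in> M. \<forall>f \<in> M. e \<noteq> f \<longrightarrow> e \<inter> f = {})"

text \<open>Meaningful for graphs with finitely many edges only, as \<open>Max\<close> of an infinite set is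
  unspecified.\<close>

definition matching_number :: "'a graph \<Rightarrow> nat" where
  "matching_number G = Max {card M | M. matching G M}"

definition divisor_elt :: "nat \<Rightarrow> nat \<Rightarrow> int \<times> int" where
  "divisor_elt n j =
    (\<one>\<^bsub>gauss_int_mod n\<^esub> \<oplus>\<^bsub>gauss_int_mod n\<^esub> imag_unit (residue_ring (2 ^ n)))
      [^]\<^bsub>gauss_int_mod n\<^esub> (2 * n - j)"

definition associate_class :: "('a, 'b) ring_scheme \<Rightarrow> 'a \<Rightarrow> 'a set" where
  "associate_class R d = {u \<otimes>\<^bsub>R\<^esub> d | u. u \<in> Units R}"

lemma cring_gauss_ring:
  assumes "cring R"
  shows "cring (gauss_ring R)"
proof -
  interpret cring R by fact
  show ?thesis
  proof (intro cringI abelian_groupI comm_monoidI)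
    fix x assume "x \<in> carrier (gauss_ring R)"
    then show "\<exists>y \<in> carrier (gauss_ring R). y \<oplus>\<^bsub>gauss_ring R\<^esub> x = \<zero>\<^bsub>gauss_ring R\<^esub>"
      by (intro bexI[of _ "(\<ominus>\<^bsub>R\<^esub> fst x, \<ominus>\<^bsub>R\<^esub> snd x)"])
         (auto simp: gauss_ring_def l_neg)
  qed (auto simp: gauss_ring_def; algebra)+
qed

lemma cring_gauss_int_mod:
  assumes "n \<ge> 1"
  shows "cring (gauss_int_mod n)"
proof -
  interpret residues "2 ^ n :: int" "residue_ring (2 ^ n)"
    using assms by unfold_locales simp_all
  show ?thesis
    unfolding gauss_int_mod_def by (intro cring_gauss_ring is_cring)
qed

end

theory Submission
  imports Defs
begin

text \<open>The level of a nonzero \<open>x = a + ib\<close>, i.e. the number of factors \<open>1 + i\<close> it contains, is the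
  2-adic valuation of \<open>a\<^sup>2 + b\<^sup>2\<close>, and \<open>xy = 0\<close> holds iff the levels of \<open>x\<close> and \<open>y\<close> add up to at
  least \<open>2n\<close>. Hence an edge avoiding the set \<open>B\<close> of levels above \<open>n\<close> joins two elements of the set
  \<open>A\<close> of level exactly \<open>n\<close>, so a matching has at most \<open>|A| / 2 + |B|\<close> edges. The bound is attained:
  \<open>A\<close> is a clique of even size, and \<open>B\<close> can be matched into the levels below \<open>n\<close>.
  Finally \<open>|A| = |V_{d_n}| = 2^{n-1}\<close>, so that \<open>|A| / 2 = |V_{d_{n-1}}|\<close>, and \<open>|B| = |A| - 1\<close>.\<close>

section \<open>Norm and reduction on integer pairs\<close>

text \<open>The norm is taken of integer representatives, not in the residue ring: a residue modulo
  \<open>2 ^ n\<close> would show its 2-adic valuation only up to \<open>n\<close>, but levels range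
  up to \<open>2 * n - 1\<close>.\<close>

definition gnorm :: "int \<times> int \<Rightarrow> int" where
  "gnorm z = (fst z)\<^sup>2 + (snd z)\<^sup>2"

definition gmult :: "int \<times> int \<Rightarrow> int \<times> int \<Rightarrow> int \<times> int" where
  "gmult z w = (fst z * fst w - snd z * snd w, fst z * snd w + snd z * fst w)"

definition gred :: "nat \<Rightarrow> int \<times> int \<Rightarrow> int \<times> int" where
  "gred n z = (fst z mod 2 ^ n, snd z mod 2 ^ n)"

text \<open>For \<open>k\<close> at most \<open>2 * n\<close> these are the representatives of the
  ideal generated by \<open>(1 + i) ^ k\<close>, zero included.\<close>

definition norm_level :: "nat \<Rightarrow> nat \<Rightarrow> (int \<times> int) set" where
  "norm_level n k = {z \<in> {0..<2 ^ n} \<times> {0..<2 ^ n}. 2 ^ k dvd gnorm z}"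

lemma gnorm_gmult: "gnorm (gmult z w) = gnorm z * gnorm w"
  by (simp add: gnorm_def gmult_def power2_eq_square algebra_simps)

lemma gnorm_scale: "gnorm (c * a, c * b) = c\<^sup>2 * gnorm (a, b)"
  by (simp add: gnorm_def power_mult_distrib algebra_simps)

lemma gnorm_eq_0_iff: "gnorm z = 0 \<longleftrightarrow> z = (0, 0)"
  by (cases z) (simp add: gnorm_def)

lemma even_gnorm_iff: "even (gnorm z) \<longleftrightarrow> (even (fst z) \<longleftrightarrow> even (snd z))"
  by (simp add: gnorm_def)

text \<open>Two odd squares add up to 2 modulo 4, which leaves only even coordinates.\<close>

lemma four_dvd_gnorm_imp_even:
  assumes "4 dvd gnorm z"
  shows "even (fst z)" "even (snd z)"
proof -
  have "even (gnorm z)"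
    using assms by (meson dvd_trans even_numeral)
  then have eq: "even (fst z) \<longleftrightarrow> even (snd z)"
    by (simp add: even_gnorm_iff)
  have "even (fst z)"
  proof (rule ccontr)
    assume odd: "odd (fst z)"
    then have "odd (snd z)" using eq by simp
    with odd obtain c d where "fst z = 2 * c + 1" "snd z = 2 * d + 1"
      by (meson oddE)
    then have "gnorm z = 4 * (c\<^sup>2 + c + d\<^sup>2 + d) + 2"
      by (simp add: gnorm_def power2_eq_square algebra_simps)
    with assms show False by presburger
  qed
  with eq show "even (fst z)" "even (snd z)" by simp_all
qed

text \<open>Since 2 is an associate of \<open>(1 + i)\<close> squared, each factor 4 of the norm
  comes from a factor 2 common to both coordinates; these are split off one by one.\<close>

lemma power_even_dvd_gnorm_iff:
  "2 ^ (2 * m) dvd gnorm z \<longleftrightarrow> 2 ^ m dvd fst z \<and> 2 ^ m dvd snd z"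
proof
  show "2 ^ m dvd fst z \<and> 2 ^ m dvd snd z" if "2 ^ (2 * m) dvd gnorm z"
    using that
  proof (induction m arbitrary: z)
    case (Suc m)
    have four: "(2::int) ^ (2 * Suc m) = 4 * 2 ^ (2 * m)" by simp
    with Suc.prems have "4 dvd gnorm z" by (metis dvd_mult_left)
    then obtain c d where "fst z = 2 * c" "snd z = 2 * d"
      using four_dvd_gnorm_imp_even by (meson evenE)
    then have z: "z = (2 * c, 2 * d)" by (simp add: prod_eq_iff)
    with Suc.prems four have "2 ^ (2 * m) dvd gnorm (c, d)"
      by (simp add: gnorm_scale)
    from Suc.IH[OF this] show ?case by (simp add: z)
  qed simp
next
  assume "2 ^ m dvd fst z \<and> 2 ^ m dvd snd z"
  then obtain c d where "z = (2 ^ m * c, 2 ^ m * d)"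
    by (metis dvdE prod.collapse)
  then have "gnorm z = (2 ^ m)\<^sup>2 * gnorm (c, d)" by (simp only: gnorm_scale)
  then show "2 ^ (2 * m) dvd gnorm z" by (simp add: power_even_eq)
qed

text \<open>Applied to a product, this turns vanishing in the ring into a condition on a product of
  norms, hence on a sum of levels.\<close>

lemma gred_eq_0_iff: "gred n z = (0, 0) \<longleftrightarrow> 2 ^ (2 * n) dvd gnorm z"
  by (simp add: gred_def power_even_dvd_gnorm_iff mod_eq_0_iff_dvd)

lemma gred_gmult_left: "gred n (gmult (gred n z) w) = gred n (gmult z w)"
  unfolding gred_def gmult_def fst_conv snd_conv prod.inject
  by (intro conjI mod_diff_cong mod_add_cong mod_mult_cong mod_mod_trivial refl)

lemma gred_gmult_gred: "gred n (gmult (gred n z) (gred n w)) = gred n (gmult z w)"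
  unfolding gred_def gmult_def fst_conv snd_conv prod.inject
  by (intro conjI mod_diff_cong mod_add_cong mod_mult_cong mod_mod_trivial refl)

lemma gred_ident: "z \<in> {0..<2 ^ n} \<times> {0..<2 ^ n} \<Longrightarrow> gred n z = z"
  by (auto simp: gred_def)

lemma gred_in_box: "gred n z \<in> {0..<2 ^ n} \<times> {0..<2 ^ n}"
  by (simp add: gred_def)

lemma even_gnorm_gred: "n \<ge> 1 \<Longrightarrow> even (gnorm (gred n z)) \<longleftrightarrow> even (gnorm z)"
  by (simp add: even_gnorm_iff gred_def dvd_mod_iff)

text \<open>Powers of \<open>1 + i\<close> are kept over the integers, where the norm is exactly
  \<open>2 ^ k\<close>; \<open>divisor_elt_eq\<close> reduces them.\<close>

fun gpow :: "nat \<Rightarrow> int \<times> int" where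
  "gpow 0 = (1, 0)"
| "gpow (Suc k) = gmult (gpow k) (1, 1)"

lemma gnorm_gpow: "gnorm (gpow k) = 2 ^ k"
proof (induction k)
  case (Suc k)
  then show ?case by (simp add: gnorm_gmult) (simp add: gnorm_def)
qed (simp add: gnorm_def)

text \<open>Divisibility of the norm by \<open>2 ^ k\<close> depends only on the residue class, being equivalent to
  annihilation by \<open>(1 + i) ^ (2 * n - k)\<close> modulo \<open>2 ^ n\<close>.\<close>

lemma power_dvd_gnorm_gred_iff:
  assumes "k \<le> 2 * n"
  shows "2 ^ k dvd gnorm (gred n z) \<longleftrightarrow> 2 ^ k dvd gnorm z"
proof -
  have *: "2 ^ k dvd gnorm w \<longleftrightarrow> gred n (gmult w (gpow (2 * n - k))) = (0, 0)" for w
  proof -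
    have "(2::int) ^ (2 * n) = 2 ^ k * 2 ^ (2 * n - k)"
      using assms by (simp flip: power_add)
    then show ?thesis
      by (simp add: gred_eq_0_iff gnorm_gmult gnorm_gpow)
  qed
  show ?thesis by (simp add: * gred_gmult_left)
qed

text \<open>An even norm means that the coordinates have equal parity, and then one factor
  \<open>1 + i\<close> can be divided out, which halves the norm.\<close>

lemma gpow_factor:
  assumes "2 ^ k dvd gnorm z"
  obtains u where "z = gmult u (gpow k)"
  using assms
proof (induction k arbitrary: z thesis)
  case 0
  show ?case by (rule "0.prems"(1)[of z]) (simp add: gmult_def)
next
  case (Suc k)
  have "even (gnorm z)"
    using Suc.prems(2) by (metis dvd_mult_left power_Suc)
  then have "even (fst z + snd z)" by (simp add: even_gnorm_iff)
  then obtain c where c: "fst z + snd z = 2 * c" by (meson evenE)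
  \<comment> \<open>The quotient of \<open>a + ib\<close> by \<open>1 + i\<close> is
    \<open>((a + b) + i(b - a)) / 2\<close>; here \<open>a + b = 2 * c\<close>, so
    \<open>(b - a) / 2 = c - a\<close>.\<close>
  define w where "w = (c, c - fst z)"
  have z: "z = gmult w (1, 1)"
    using c by (simp add: w_def gmult_def prod_eq_iff)
  then have "gnorm z = gnorm w * 2"
    by (simp add: gnorm_gmult) (simp add: gnorm_def)
  then have "2 ^ k dvd gnorm w" using Suc.prems(2) by simp
  then obtain u where "w = gmult u (gpow k)" using Suc.IH by blast
  then have "z = gmult u (gpow (Suc k))"
    by (simp add: z gmult_def algebra_simps)
  then show ?case by (rule Suc.prems(1))
qed

section \<open>Sizes of the ideals generated by powers of \<open>1 + i\<close>\<close>

lemma finite_norm_level [simp]: "finite (norm_level n k)"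
  by (simp add: norm_level_def)

lemma norm_level_mono: "k \<le> l \<Longrightarrow> norm_level n l \<subseteq> norm_level n k"
  by (auto simp: norm_level_def intro: dvd_trans[OF le_imp_power_dvd])

lemma card_interval: "card {0..<2 ^ k :: int} = 2 ^ k"
  by (simp add: nat_power_eq)

text \<open>The first coordinate is free and fixes the parity of the second, of which only the half
  remains to be chosen.\<close>

lemma card_norm_level_1: "card (norm_level (Suc n) 1) = 2 ^ (2 * n + 1)"
proof -
  let ?f = "\<lambda>(a, c). (a, 2 * c + a mod 2) :: int \<times> int"
  have "bij_betw ?f ({0..<2 ^ Suc n} \<times> {0..<2 ^ n}) (norm_level (Suc n) 1)"
    unfolding bij_betw_def
  proof
    show "inj_on ?f ({0..<2 ^ Suc n} \<times> {0..<2 ^ n})"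
      by (auto simp: inj_on_def)
    show "?f ` ({0..<2 ^ Suc n} \<times> {0..<2 ^ n}) = norm_level (Suc n) 1" (is "?L = ?R")
    proof
      show "?L \<subseteq> ?R"
      proof
        fix x assume "x \<in> ?L"
        then obtain a c where x: "x = (a, 2 * c + a mod 2)"
          and a: "0 \<le> a" "a < 2 ^ Suc n" and c: "0 \<le> c" "c < 2 ^ n" by auto
        have "0 \<le> a mod 2" "a mod 2 \<le> 1" by simp_all
        with c have "0 \<le> 2 * c + a mod 2" "2 * c + a mod 2 < 2 ^ Suc n" by simp_all
        with a show "x \<in> ?R"
          by (simp add: x norm_level_def even_gnorm_iff)
      qed
      show "?R \<subseteq> ?L"
      proof
        fix x assume "x \<in> ?R"
        then have x: "0 \<le> fst x" "fst x < 2 ^ Suc n" "0 \<le> snd x" "snd x < 2 ^ Suc n"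
          and "even (fst x) \<longleftrightarrow> even (snd x)"
          by (auto simp: norm_level_def even_gnorm_iff)
        then have "x = ?f (fst x, snd x div 2)"
          by (simp add: prod_eq_iff) presburger
        moreover have "(fst x, snd x div 2) \<in> {0..<2 ^ Suc n} \<times> {0..<2 ^ n}"
          using x by auto
        ultimately show "x \<in> ?L" by (rule image_eqI)
      qed
    qed
  qed
  from bij_betw_same_card[OF this] have "card (norm_level (Suc n) 1) = 2 ^ Suc n * 2 ^ n"
    by (simp only: card_cartesian_product card_interval)
  then show ?thesis by (simp only: mult_2 add_Suc_right add_Suc Suc_eq_plus1 flip: power_add) simp
qed

text \<open>Doubling multiplies the norm by 4 and maps the box of side \<open>2 ^ n\<close> onto the
  even points of the box of side \<open>2 ^ Suc n\<close>.\<close>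

lemma card_norm_level_Suc_Suc: "card (norm_level (Suc n) (Suc (Suc k))) = card (norm_level n k)"
proof -
  let ?f = "\<lambda>(a, b). (2 * a, 2 * b) :: int \<times> int"
  have norm: "gnorm (2 * a, 2 * b) = 4 * gnorm (a, b)" for a b
    by (simp add: gnorm_scale)
  have "bij_betw ?f (norm_level n k) (norm_level (Suc n) (Suc (Suc k)))"
    unfolding bij_betw_def
  proof
    show "inj_on ?f (norm_level n k)" by (auto simp: inj_on_def)
    show "?f ` norm_level n k = norm_level (Suc n) (Suc (Suc k))" (is "?L = ?R")
    proof
      show "?L \<subseteq> ?R"
        by (auto simp: norm_level_def norm mult_dvd_mono)
      show "?R \<subseteq> ?L"
      proof
        fix x assume x: "x \<in> ?R"
        then have d: "4 * 2 ^ k dvd gnorm x" by (simp add: norm_level_def)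
        then have "4 dvd gnorm x" by (rule dvd_mult_left)
        then obtain a b where "fst x = 2 * a" "snd x = 2 * b"
          using four_dvd_gnorm_imp_even by (meson evenE)
        then have ab: "x = (2 * a, 2 * b)" by (simp add: prod_eq_iff)
        with d have "2 ^ k dvd gnorm (a, b)" by (simp add: norm)
        with x have "(a, b) \<in> norm_level n k" by (auto simp: norm_level_def ab)
        with ab show "x \<in> ?L" by force
      qed
    qed
  qed
  from bij_betw_same_card[OF this] show ?thesis by simp
qed

text \<open>Lowering \<open>n\<close> by one lowers \<open>k\<close> by two, so the induction step
  needs a direct count only for \<open>k = 0\<close> and \<open>k = 1\<close>.\<close>

lemma card_norm_level: "k \<le> 2 * n \<Longrightarrow> card (norm_level n k) = 2 ^ (2 * n - k)"
proof (induction n arbitrary: k)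
  case 0
  then have "norm_level 0 k = {(0, 0)}" by (auto simp: norm_level_def)
  with 0 show ?case by simp
next
  case (Suc n)
  consider "k = 0" | "k = 1" | l where "k = Suc (Suc l)"
    by (metis One_nat_def not0_implies_Suc)
  then show ?case
  proof cases
    case 1
    then have "norm_level (Suc n) k = {0..<2 ^ Suc n} \<times> {0..<2 ^ Suc n}"
      by (auto simp: norm_level_def)
    with 1 show ?thesis
      by (simp only: card_cartesian_product card_interval mult_2 diff_zero flip: power_add)
  next
    case 2
    then show ?thesis using card_norm_level_1[of n] by simp
  next
    case 3
    then show ?thesis using Suc by (simp add: card_norm_level_Suc_Suc)
  qed
qed

section \<open>Ring operations, units and associate classes\<close>

lemma gauss_int_mod_simps:
  assumes "n \<ge> 1"
  shows "carrier (gauss_int_mod n) = {0..<2 ^ n} \<times> {0..<2 ^ n}"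
    and "\<zero>\<^bsub>gauss_int_mod n\<^esub> = (0, 0)"
    and "\<one>\<^bsub>gauss_int_mod n\<^esub> = (1, 0)"
    and "z \<otimes>\<^bsub>gauss_int_mod n\<^esub> w = gred n (gmult z w)"
    and "\<one>\<^bsub>gauss_int_mod n\<^esub> \<oplus>\<^bsub>gauss_int_mod n\<^esub> imag_unit (residue_ring (2 ^ n)) = (1, 1)"
proof -
  have gt: "(1::int) < 2 ^ n" using assms by simp
  interpret residues "2 ^ n :: int" "residue_ring (2 ^ n)"
    using gt by unfold_locales simp_all
  show "carrier (gauss_int_mod n) = {0..<2 ^ n} \<times> {0..<2 ^ n}"
    by (auto simp: gauss_int_mod_def gauss_ring_def residue_ring_def)
  show "\<zero>\<^bsub>gauss_int_mod n\<^esub> = (0, 0)" "\<one>\<^bsub>gauss_int_mod n\<^esub> = (1, 0)"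
    by (simp_all add: gauss_int_mod_def gauss_ring_def residue_ring_def)
  show "z \<otimes>\<^bsub>gauss_int_mod n\<^esub> w = gred n (gmult z w)"
    by (cases z; cases w)
      (simp add: gauss_int_mod_def gauss_ring_def gred_def gmult_def a_minus_def res_add_eq
        res_mult_eq res_neg_eq mod_simps)
  show "\<one>\<^bsub>gauss_int_mod n\<^esub> \<oplus>\<^bsub>gauss_int_mod n\<^esub> imag_unit (residue_ring (2 ^ n)) = (1, 1)"
    using assms by (simp add: gauss_int_mod_def gauss_ring_def imag_unit_def residue_ring_def)
qed

lemma divisor_elt_eq:
  assumes "n \<ge> 1"
  shows "divisor_elt n j = gred n (gpow (2 * n - j))"
proof -
  have "(1, 1) [^]\<^bsub>gauss_int_mod n\<^esub> k = gred n (gpow k)" for k :: nat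
  proof (induction k)
    case 0
    then show ?case using assms by (simp add: gauss_int_mod_simps gred_def nat_pow_def)
  next
    case (Suc k)
    then show ?case using assms by (simp add: gauss_int_mod_simps gred_gmult_left nat_pow_def)
  qed
  then show ?thesis by (simp only: divisor_elt_def gauss_int_mod_simps(5)[OF assms])
qed

lemma gauss_int_mod_Units_iff:
  assumes "n \<ge> 1"
  shows "u \<in> Units (gauss_int_mod n) \<longleftrightarrow> u \<in> {0..<2 ^ n} \<times> {0..<2 ^ n} \<and> odd (gnorm u)"
proof
  assume "u \<in> Units (gauss_int_mod n)"
  then obtain w where u: "u \<in> {0..<2 ^ n} \<times> {0..<2 ^ n}" and "gred n (gmult u w) = (1, 0)"
    using assms by (auto simp: Units_def gauss_int_mod_simps)
  \<comment> \<open>Reduction keeps the parity of the norm, and \<open>(1, 0)\<close> has norm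
    1.\<close>
  then have "odd (gnorm (gmult u w))"
    using even_gnorm_gred[OF assms, of "gmult u w"] by (simp add: gnorm_def)
  with u show "u \<in> {0..<2 ^ n} \<times> {0..<2 ^ n} \<and> odd (gnorm u)"
    by (simp add: gnorm_gmult)
next
  assume u: "u \<in> {0..<2 ^ n} \<times> {0..<2 ^ n} \<and> odd (gnorm u)"
  then have "coprime (gnorm u) (2 ^ n)" by simp
  then obtain t where t: "[gnorm u * t = 1] (mod 2 ^ n)"
    using cong_solve_coprime_int by blast
  \<comment> \<open>The inverse is the conjugate of \<open>u\<close> divided by its norm, where
    \<open>t\<close> inverts the norm modulo \<open>2 ^ n\<close>.\<close>
  define w where "w = gred n (fst u * t, - snd u * t)"
  have "gred n (gmult u w) = gred n (gmult (gred n u) w)"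
    by (simp add: gred_gmult_left)
  also have "\<dots> = gred n (gmult u (fst u * t, - snd u * t))"
    by (simp only: w_def gred_gmult_gred)
  also have "gmult u (fst u * t, - snd u * t) = (gnorm u * t, 0)"
    by (simp add: gmult_def gnorm_def power2_eq_square algebra_simps)
  also have "gred n \<dots> = (1, 0)"
    using t assms by (simp add: gred_def cong_def)
  finally have uw: "gred n (gmult u w) = (1, 0)" .
  moreover have "gmult w u = gmult u w" by (simp add: gmult_def algebra_simps)
  ultimately have "gred n (gmult w u) = (1, 0)" by simp
  moreover have "w \<in> {0..<2 ^ n} \<times> {0..<2 ^ n}" by (simp only: w_def gred_in_box)
  ultimately show "u \<in> Units (gauss_int_mod n)"
    unfolding Units_def gauss_int_mod_simps(1,3,4)[OF assms] using u uw by blast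
qed

text \<open>In \<open>u * (1 + i) ^ k\<close> the factor \<open>u\<close> is a unit modulo
  \<open>2 ^ n\<close> exactly if its norm is odd, that is, if no further \<open>1 + i\<close>
  divides out. The bound \<open>k < 2 * n\<close> ensures that level \<open>Suc k\<close> is still
  visible after reduction.\<close>

lemma associate_class_gpow:
  assumes "n \<ge> 1" "k < 2 * n"
  shows "associate_class (gauss_int_mod n) (gred n (gpow k)) = norm_level n k - norm_level n (Suc k)"
    (is "?L = ?R")
proof
  have prod: "u \<otimes>\<^bsub>gauss_int_mod n\<^esub> gred n (gpow k) = gred n (gmult u (gpow k))"
    if "u \<in> {0..<2 ^ n} \<times> {0..<2 ^ n}" for u
    using that assms gred_gmult_gred[of n u "gpow k"] by (simp add: gauss_int_mod_simps gred_ident)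
  have level: "gred n (gmult u (gpow k)) \<in> ?R \<longleftrightarrow> odd (gnorm u)" for u
  proof -
    have "2 ^ Suc k dvd gnorm (gmult u (gpow k)) \<longleftrightarrow> even (gnorm u)"
      by (simp add: gnorm_gmult gnorm_gpow)
    then show ?thesis
      using assms gred_in_box[of n "gmult u (gpow k)"]
      by (simp add: norm_level_def power_dvd_gnorm_gred_iff gnorm_gmult gnorm_gpow del: power_Suc)
  qed
  show "?L \<subseteq> ?R"
  proof
    fix x assume "x \<in> ?L"
    then obtain u where "u \<in> {0..<2 ^ n} \<times> {0..<2 ^ n}" "odd (gnorm u)"
      "x = u \<otimes>\<^bsub>gauss_int_mod n\<^esub> gred n (gpow k)"
      using assms by (auto simp: associate_class_def gauss_int_mod_Units_iff)
    then show "x \<in> ?R" by (simp only: prod level not_False_eq_True)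
  qed
  show "?R \<subseteq> ?L"
  proof
    fix x assume x: "x \<in> ?R"
    then have "2 ^ k dvd gnorm x" and red: "gred n x = x"
      by (auto simp: norm_level_def gred_ident)
    then obtain u where u: "x = gmult u (gpow k)" using gpow_factor by blast
    with red x have "odd (gnorm u)" using level[of u] by simp
    then have unit: "gred n u \<in> Units (gauss_int_mod n)"
      using assms gred_in_box by (simp add: gauss_int_mod_Units_iff even_gnorm_gred)
    have "x = gred n u \<otimes>\<^bsub>gauss_int_mod n\<^esub> gred n (gpow k)"
      using red u by (simp add: prod[OF gred_in_box] gred_gmult_left)
    with unit show "x \<in> ?L" unfolding associate_class_def by blast
  qed
qed

text \<open>The class is the difference of two consecutive ideals, of sizes \<open>2 ^ j\<close> and
  \<open>2 ^ (j - 1)\<close>.\<close>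

lemma card_associate_class_divisor_elt:
  assumes "1 \<le> j" "j \<le> 2 * n"
  shows "card (associate_class (gauss_int_mod n) (divisor_elt n j)) = 2 ^ (j - 1)"
proof -
  have n: "n \<ge> 1" using assms by simp
  have "card (norm_level n (2 * n - j) - norm_level n (Suc (2 * n - j)))
      = 2 ^ (2 * n - (2 * n - j)) - 2 ^ (2 * n - Suc (2 * n - j))"
    using assms by (simp add: card_Diff_subset norm_level_mono card_norm_level)
  also have "\<dots> = 2 ^ (j - 1)"
    using assms by (cases j) simp_all
  finally show ?thesis
    using assms n by (simp add: divisor_elt_eq associate_class_gpow)
qed

section \<open>Counting disjoint edges\<close>

text \<open>Choosing a point of \<open>B\<close> on each edge that meets \<open>B\<close> is
  injective by disjointness; the remaining edges are disjoint pairs inside \<open>A\<close>.\<close>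

lemma card_disjoint_edges_le:
  assumes "finite A" "finite B"
    and disj: "\<forall>e \<in> M. \<forall>f \<in> M. e \<noteq> f \<longrightarrow> e \<inter> f = {}"
    and edge: "\<And>e. e \<in> M \<Longrightarrow> card e = 2"
    and cover: "\<And>e. e \<in> M \<Longrightarrow> e \<inter> B = {} \<Longrightarrow> e \<subseteq> A"
  shows "card M \<le> card A div 2 + card B"
proof -
  define M1 where "M1 = {e \<in> M. e \<inter> B \<noteq> {}}"
  define M2 where "M2 = {e \<in> M. e \<inter> B = {}}"
  define g where "g e = (SOME x. x \<in> e \<inter> B)" for e
  have g: "g e \<in> e \<inter> B" if "e \<in> M1" for e
  proof -
    obtain x where "x \<in> e \<inter> B" using \<open>e \<in> M1\<close> by (auto simp: M1_def)
    then show ?thesis unfolding g_def by (rule someI)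
  qed
  have "inj_on g M1"
  proof (rule inj_onI)
    fix e f assume "e \<in> M1" "f \<in> M1" "g e = g f"
    then have "g e \<in> e \<inter> f" using g[of e] g[of f] by auto
    then show "e = f" using disj \<open>e \<in> M1\<close> \<open>f \<in> M1\<close> by (auto simp: M1_def)
  qed
  then have M1: "card M1 \<le> card B"
    by (rule card_inj_on_le) (use g \<open>finite B\<close> in auto)
  have sub: "\<Union> M2 \<subseteq> A" using cover by (auto simp: M2_def)
  have "card (\<Union> M2) = (\<Sum>e\<in>M2. card e)"
    by (rule card_Union_disjoint)
      (use disj edge in \<open>auto simp: M2_def pairwise_def disjnt_def intro: card_ge_0_finite\<close>)
  also have "\<dots> = 2 * card M2" using edge by (simp add: M2_def)
  finally have "2 * card M2 \<le> card A" using card_mono[OF \<open>finite A\<close> sub] by simp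
  then have M2: "card M2 \<le> card A div 2" by simp
  have "M = M1 \<union> M2" by (auto simp: M1_def M2_def)
  then have "card M \<le> card M1 + card M2" by (simp add: card_Un_le)
  with M1 M2 show ?thesis by simp
qed

lemma ex_disjoint_pairs:
  assumes "finite S" "2 * k \<le> card S"
  shows "\<exists>P. finite P \<and> card P = k \<and> (\<forall>e \<in> P. e \<subseteq> S \<and> card e = 2)
    \<and> (\<forall>e \<in> P. \<forall>f \<in> P. e \<noteq> f \<longrightarrow> e \<inter> f = {})"
  using assms
proof (induction k arbitrary: S)
  case 0
  then show ?case by (intro exI[of _ "{}"]) simp
next
  case (Suc k)
  then have "2 \<le> card S" by simp
  then obtain e where e: "e \<subseteq> S" "card e = 2"
    by (meson obtain_subset_with_card_n)
  then have "2 * k \<le> card (S - e)"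
    using Suc.prems by (simp add: card_Diff_subset finite_subset)
  then obtain P where P: "finite P" "card P = k" "\<forall>f \<in> P. f \<subseteq> S - e \<and> card f = 2"
    "\<forall>f \<in> P. \<forall>g \<in> P. f \<noteq> g \<longrightarrow> f \<inter> g = {}"
    using Suc.IH[of "S - e"] Suc.prems by auto
  have "e \<notin> P"
  proof
    assume "e \<in> P"
    with P(3) have "e = {}" by blast
    with e(2) show False by simp
  qed
  then show ?case
    using P e by (intro exI[of _ "insert e P"]) (auto; blast)
qed

section \<open>Edges in terms of levels, and reflection about level \<open>n\<close>\<close>

text \<open>The endpoints of an edge witness for each other that they are zero divisors, so being
  nonzero is all that is left of the vertex condition.\<close>

lemma zero_divisor_graph_edge_iff:
  assumes "n \<ge> 1"
  shows "{x, y} \<in> snd (zero_divisor_graph (gauss_int_mod n)) \<longleftrightarrow>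
    x \<in> {0..<2 ^ n} \<times> {0..<2 ^ n} - {(0, 0)} \<and> y \<in> {0..<2 ^ n} \<times> {0..<2 ^ n} - {(0, 0)}
    \<and> x \<noteq> y \<and> 2 ^ (2 * n) dvd gnorm x * gnorm y"
proof -
  have mult: "x \<otimes>\<^bsub>gauss_int_mod n\<^esub> y = \<zero>\<^bsub>gauss_int_mod n\<^esub> \<longleftrightarrow> 2 ^ (2 * n) dvd gnorm x * gnorm y" for x y
    using assms by (simp add: gauss_int_mod_simps gred_eq_0_iff gnorm_gmult)
  let ?V = "{0..<2 ^ n} \<times> {0..<2 ^ n} - {(0, 0)} :: (int \<times> int) set"
  have vertex: "x \<in> nonzero_zero_divisors (gauss_int_mod n)
      \<longleftrightarrow> x \<in> ?V \<and> (\<exists>y \<in> ?V. 2 ^ (2 * n) dvd gnorm x * gnorm y)" for x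
    unfolding nonzero_zero_divisors_def mult using assms by (simp add: gauss_int_mod_simps)
  have "{x, y} \<in> snd (zero_divisor_graph (gauss_int_mod n)) \<longleftrightarrow>
    x \<in> nonzero_zero_divisors (gauss_int_mod n) \<and> y \<in> nonzero_zero_divisors (gauss_int_mod n)
    \<and> x \<noteq> y \<and> 2 ^ (2 * n) dvd gnorm x * gnorm y"
    (is "?L \<longleftrightarrow> ?R")
  proof
    show "?R" if "?L"
      using that unfolding zero_divisor_graph_def mult
      by (auto simp: doubleton_eq_iff mult.commute)
    show "?L" if "?R"
      using that unfolding zero_divisor_graph_def mult snd_conv by blast
  qed
  also have "\<dots> \<longleftrightarrow> x \<in> ?V \<and> y \<in> ?V \<and> x \<noteq> y \<and> 2 ^ (2 * n) dvd gnorm x * gnorm y"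
    unfolding vertex by (auto simp: mult.commute)
  finally show ?thesis .
qed

lemma zero_divisor_graph_edgeE:
  assumes "e \<in> snd (zero_divisor_graph R)"
  obtains x y where "e = {x, y}" "x \<noteq> y"
  using assms by (auto simp: zero_divisor_graph_def)

lemma norm_level_multiplicity_iff:
  assumes "x \<in> {0..<2 ^ n} \<times> {0..<2 ^ n} - {(0, 0)}"
  shows "x \<in> norm_level n k \<longleftrightarrow> k \<le> multiplicity 2 (gnorm x)"
  using assms by (auto simp: norm_level_def power_dvd_iff_le_multiplicity gnorm_eq_0_iff)

lemma multiplicity_gnorm_less:
  assumes "x \<in> {0..<2 ^ n} \<times> {0..<2 ^ n} - {(0, 0)}"
  shows "multiplicity 2 (gnorm x) < 2 * n"
proof (rule ccontr)
  assume "\<not> ?thesis"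
  then have "2 ^ (2 * n) dvd gnorm x" by (intro multiplicity_dvd') simp
  then have "gred n x = (0, 0)" by (simp add: gred_eq_0_iff)
  with assms show False by (simp add: gred_ident)
qed

lemma power_dvd_gnorm_mult_iff:
  assumes "x \<noteq> (0, 0)" "y \<noteq> (0, 0)"
  shows "2 ^ k dvd gnorm x * gnorm y \<longleftrightarrow> k \<le> multiplicity 2 (gnorm x) + multiplicity 2 (gnorm y)"
  using assms
  by (simp add: power_dvd_iff_le_multiplicity gnorm_eq_0_iff prime_elem_multiplicity_mult_distrib)

text \<open>Elements of level above \<open>n\<close> are matched below \<open>n\<close> by dividing out as many factors \<open>2\<close> as the
  level exceeds \<open>n\<close>, which reflects the level about \<open>n\<close>.\<close>

definition reflect :: "nat \<Rightarrow> int \<times> int \<Rightarrow> int \<times> int" where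
  "reflect n x = (let d = 2 ^ (multiplicity 2 (gnorm x) - n) in (fst x div d, snd x div d))"

lemma reflect:
  assumes x: "x \<in> {0..<2 ^ n} \<times> {0..<2 ^ n} - {(0, 0)}" and gt: "n < multiplicity 2 (gnorm x)"
  shows "reflect n x \<in> {0..<2 ^ n} \<times> {0..<2 ^ n} - {(0, 0)}"
    and "multiplicity 2 (gnorm (reflect n x)) + multiplicity 2 (gnorm x) = 2 * n"
    and "x = (2 ^ (multiplicity 2 (gnorm x) - n) * fst (reflect n x),
          2 ^ (multiplicity 2 (gnorm x) - n) * snd (reflect n x))"
proof -
  define j where "j = multiplicity 2 (gnorm x) - n"
  \<comment> \<open>As the level is below \<open>2 * n\<close>, twice its excess over
    \<open>n\<close> does not exceed the level itself, so the division by \<open>2 ^ j\<close> is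
    exact.\<close>
  have "2 * j \<le> multiplicity 2 (gnorm x)"
    using multiplicity_gnorm_less[OF x] gt by (simp add: j_def)
  then have "2 ^ (2 * j) dvd gnorm x" by (rule multiplicity_dvd')
  then have dvd: "2 ^ j dvd fst x" "2 ^ j dvd snd x"
    by (simp_all add: power_even_dvd_gnorm_iff)
  have refl: "reflect n x = (fst x div 2 ^ j, snd x div 2 ^ j)"
    by (simp add: reflect_def j_def Let_def)
  have eq: "x = (2 ^ j * fst (reflect n x), 2 ^ j * snd (reflect n x))"
    using dvd by (simp add: refl)
  then show "x = (2 ^ (multiplicity 2 (gnorm x) - n) * fst (reflect n x),
      2 ^ (multiplicity 2 (gnorm x) - n) * snd (reflect n x))"
    by (simp add: j_def)
  have nz: "reflect n x \<noteq> (0, 0)"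
    using eq x by auto
  have le: "a div 2 ^ j < 2 ^ n" if "0 \<le> a" "a < 2 ^ n" for a :: int
    using that zdiv_mono2[of a 1 "2 ^ j"] by simp
  show "reflect n x \<in> {0..<2 ^ n} \<times> {0..<2 ^ n} - {(0, 0)}"
    using nz x le by (auto simp: refl pos_imp_zdiv_nonneg_iff)
  \<comment> \<open>Dividing by \<open>2 ^ j\<close> lowers the level by \<open>2 * j\<close>, twice
    the excess over \<open>n\<close>, hence to its mirror image.\<close>
  have "gnorm x = 2 ^ (2 * j) * gnorm (reflect n x)"
    by (subst eq) (simp only: gnorm_scale power_even_eq prod.collapse)
  then have "multiplicity 2 (gnorm x) = 2 * j + multiplicity 2 (gnorm (reflect n x))"
    using nz by (simp add: prime_elem_multiplicity_mult_distrib gnorm_eq_0_iff)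
  then show "multiplicity 2 (gnorm (reflect n x)) + multiplicity 2 (gnorm x) = 2 * n"
    using gt by (simp add: j_def)
qed

text \<open>The level of the image determines the level of \<open>x\<close>, hence the power of 2
  that was divided out.\<close>

lemma inj_on_reflect:
  "inj_on (reflect n) {x \<in> {0..<2 ^ n} \<times> {0..<2 ^ n} - {(0, 0)}. n < multiplicity 2 (gnorm x)}"
proof (rule inj_onI)
  fix x y
  assume "x \<in> {x \<in> {0..<2 ^ n} \<times> {0..<2 ^ n} - {(0, 0)}. n < multiplicity 2 (gnorm x)}"
    and "y \<in> {x \<in> {0..<2 ^ n} \<times> {0..<2 ^ n} - {(0, 0)}. n < multiplicity 2 (gnorm x)}"
    and eq: "reflect n x = reflect n y"
  then have x: "x \<in> {0..<2 ^ n} \<times> {0..<2 ^ n} - {(0, 0)}" "n < multiplicity 2 (gnorm x)"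
    and y: "y \<in> {0..<2 ^ n} \<times> {0..<2 ^ n} - {(0, 0)}" "n < multiplicity 2 (gnorm y)"
    by blast+
  from reflect(2)[OF x] reflect(2)[OF y] eq
  have level_eq: "multiplicity 2 (gnorm x) = multiplicity 2 (gnorm y)" by simp
  have "x = (2 ^ (multiplicity 2 (gnorm y) - n) * fst (reflect n y),
      2 ^ (multiplicity 2 (gnorm y) - n) * snd (reflect n y))"
    using reflect(3)[OF x] unfolding eq level_eq .
  also have "\<dots> = y" using reflect(3)[OF y] by (rule sym)
  finally show "x = y" .
qed

section \<open>Upper bound and a matching that attains it\<close>

theorem theorem3p2:
  fixes n :: nat
  assumes "n \<ge> 2"
  shows "int (matching_number (zero_divisor_graph (gauss_int_mod n))) =
    int (card (associate_class (gauss_int_mod n) (divisor_elt n n)))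
    + int (card (associate_class (gauss_int_mod n) (divisor_elt n (n - 1)))) - 1"
proof -
  define G where "G = zero_divisor_graph (gauss_int_mod n)"
  define V where "V = ({0..<2 ^ n} \<times> {0..<2 ^ n} - {(0, 0)} :: (int \<times> int) set)"
  define v where "v x = multiplicity 2 (gnorm x)" for x
  define A where "A = {x \<in> V. v x = n}"
  define B where "B = {x \<in> V. n < v x}"
  have n: "n \<ge> 1" using assms by simp
  have finite: "finite V" "finite A" "finite B" by (auto simp: V_def A_def B_def)
  have level: "x \<in> norm_level n k \<longleftrightarrow> k \<le> v x" if "x \<in> V" for x k
    using that by (simp add: V_def v_def norm_level_multiplicity_iff)
  have zero: "(0, 0) \<in> norm_level n k" for k
    by (simp add: norm_level_def gnorm_def)
  have sub: "norm_level n k - {(0, 0)} \<subseteq> V" for k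
    by (auto simp: V_def norm_level_def)
  \<comment> \<open>Zero lies in every \<open>norm_level\<close> but is no vertex. Removing it costs
    the 1 in \<open>card B\<close>; in the difference describing \<open>A\<close> it
    cancels.\<close>
  have "B = norm_level n (Suc n) - {(0, 0)}"
  proof (rule Set.set_eqI)
    fix x
    show "x \<in> B \<longleftrightarrow> x \<in> norm_level n (Suc n) - {(0, 0)}"
    proof (cases "x \<in> V")
      case True
      then have "x \<noteq> (0, 0)" by (auto simp: V_def)
      with True show ?thesis by (simp add: B_def level Suc_le_eq)
    next
      case False
      then show ?thesis using sub by (auto simp: B_def)
    qed
  qed
  then have "card B = 2 ^ (2 * n - Suc n) - 1"
    using assms zero by (simp add: card_norm_level)
  then have card_B: "card B = 2 ^ (n - 1) - 1" by simp
  have "A = norm_level n n - norm_level n (Suc n)"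
  proof (rule Set.set_eqI)
    fix x
    show "x \<in> A \<longleftrightarrow> x \<in> norm_level n n - norm_level n (Suc n)"
    proof (cases "x \<in> V")
      case True
      then show ?thesis by (simp add: A_def level) linarith
    next
      case False
      then show ?thesis using sub[of n] zero[of "Suc n"] unfolding A_def by blast
    qed
  qed
  then have "card A = 2 ^ n - 2 ^ (n - 1)"
    using assms by (simp add: card_Diff_subset norm_level_mono card_norm_level)
  \<comment> \<open>From \<open>n >= 2\<close> it follows that \<open>card A = 2 ^ (n - 1)\<close>
    is even, so \<open>A\<close> can be paired off completely.\<close>
  moreover have "(2::nat) ^ n = 2 * 2 ^ (n - 1)" "(2::nat) ^ (n - 1) = 2 * 2 ^ (n - 2)"
    using assms by (simp_all flip: power_Suc add: Suc_diff_Suc numeral_2_eq_2)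
  ultimately have card_A: "card A = 2 * 2 ^ (n - 2)" by simp
  have edge: "{x, y} \<in> snd G \<longleftrightarrow> x \<in> V \<and> y \<in> V \<and> x \<noteq> y \<and> 2 * n \<le> v x + v y" for x y
    using power_dvd_gnorm_mult_iff[of x y "2 * n"]
    by (auto simp: G_def V_def v_def zero_divisor_graph_edge_iff[OF n])
  have edgeE: thesis
    if "e \<in> snd G" "\<And>x y. e = {x, y} \<Longrightarrow> x \<noteq> y \<Longrightarrow> x \<in> V \<Longrightarrow> y \<in> V \<Longrightarrow> 2 * n \<le> v x + v y \<Longrightarrow> thesis"
    for e thesis
    using that edge unfolding G_def by (metis zero_divisor_graph_edgeE)
  have upper: "card M \<le> 2 ^ (n - 2) + card B" if "matching G M" for M
  proof -
    have "card M \<le> card A div 2 + card B"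
    proof (rule card_disjoint_edges_le[OF finite(2,3)])
      show "\<forall>e \<in> M. \<forall>f \<in> M. e \<noteq> f \<longrightarrow> e \<inter> f = {}"
        using that by (simp add: matching_def)
      fix e assume "e \<in> M"
      with \<open>matching G M\<close> have "e \<in> snd G" by (auto simp: matching_def)
      then obtain x y where e: "e = {x, y}" "x \<noteq> y" and xy: "x \<in> V" "y \<in> V" "2 * n \<le> v x + v y"
        by (rule edgeE)
      from e show "card e = 2" by simp
      assume "e \<inter> B = {}"
      \<comment> \<open>Two levels of at most \<open>n\<close> with sum at least
        \<open>2 * n\<close> both equal \<open>n\<close>.\<close>
      with xy have "v x \<le> n" "v y \<le> n" by (auto simp: e B_def)
      with xy show "e \<subseteq> A" by (simp add: e A_def)
    qed
    then show ?thesis by (simp add: card_A)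
  qed
  \<comment> \<open>Any two distinct elements of \<open>A\<close> are adjacent because
    \<open>n + n = 2 * n\<close>, so every pairing of \<open>A\<close> consists of edges.\<close>
  obtain P where P: "finite P" "card P = 2 ^ (n - 2)" "\<forall>e \<in> P. e \<subseteq> A \<and> card e = 2"
    "\<forall>e \<in> P. \<forall>f \<in> P. e \<noteq> f \<longrightarrow> e \<inter> f = {}"
    using ex_disjoint_pairs[OF finite(2), of "2 ^ (n - 2)"] card_A by auto
  \<comment> \<open>The partner of \<open>x\<close> has level \<open>2 * n - v x\<close>, just
    enough for adjacency and below \<open>n\<close>, hence outside \<open>A\<close> and
    \<open>B\<close>.\<close>
  define Q where "Q = (\<lambda>x. {x, reflect n x}) ` B"
  have refl: "reflect n x \<in> V" "v (reflect n x) + v x = 2 * n" if "x \<in> B" for x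
    using that reflect(1,2)[of x n] by (auto simp: B_def V_def v_def)
  have refl_notin: "reflect n x \<notin> A" "reflect n x \<notin> B" if "x \<in> B" for x
    using refl[OF that] that by (auto simp: A_def B_def)
  have refl_inj: "inj_on (reflect n) B"
    unfolding B_def V_def v_def by (rule inj_on_reflect)
  \<comment> \<open>Equal pairs with the roles of the two points exchanged would put a reflected
    point into \<open>B\<close>.\<close>
  have "inj_on (\<lambda>x. {x, reflect n x}) B"
    by (intro inj_onI) (metis doubleton_eq_iff refl_notin(2))
  then have card_Q: "card Q = card B" by (simp add: Q_def card_image)
  have "e \<inter> f = {}" if "e \<in> P" "f \<in> Q" for e f
    using that P(3) refl_notin by (fastforce simp: Q_def A_def B_def)
  then have disj: "\<forall>e \<in> P. \<forall>f \<in> Q. e \<inter> f = {}" by blast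
  have "matching G (P \<union> Q)"
    unfolding matching_def
  proof
    show "P \<union> Q \<subseteq> snd G"
    proof
      fix e assume "e \<in> P \<union> Q"
      then show "e \<in> snd G"
      proof
        assume "e \<in> P"
        with P(3) obtain x y where "e = {x, y}" "x \<noteq> y" "x \<in> A" "y \<in> A"
          by (metis card_2_iff insert_subset)
        then show ?thesis by (simp add: edge A_def)
      next
        assume "e \<in> Q"
        then obtain x where "e = {x, reflect n x}" "x \<in> B" by (auto simp: Q_def)
        then show ?thesis using refl[of x] refl_notin[of x] by (auto simp: edge B_def)
      qed
    qed
    have "\<forall>e \<in> Q. \<forall>f \<in> Q. e \<noteq> f \<longrightarrow> e \<inter> f = {}"
    proof (intro ballI impI)
      fix e f assume "e \<in> Q" "f \<in> Q" "e \<noteq> f"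
      then obtain x y where xy: "x \<in> B" "y \<in> B" "e = {x, reflect n x}" "f = {y, reflect n y}"
        by (auto simp only: Q_def)
      with \<open>e \<noteq> f\<close> have "reflect n x \<noteq> reflect n y" by (metis refl_inj inj_onD)
      moreover have "x \<noteq> reflect n y" "y \<noteq> reflect n x" "x \<noteq> y"
        using xy \<open>e \<noteq> f\<close> refl_notin(2) by metis+
      ultimately show "e \<inter> f = {}" using xy by simp
    qed
    with P(4) disj show "\<forall>e \<in> P \<union> Q. \<forall>f \<in> P \<union> Q. e \<noteq> f \<longrightarrow> e \<inter> f = {}"
      by (metis Int_commute Un_iff)
  qed
  moreover have "card (P \<union> Q) = 2 ^ (n - 2) + card B"
  proof -
    \<comment> \<open>A common edge would be disjoint from itself, hence empty, but the edges in
      \<open>P\<close> have two points.\<close>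
    have "P \<inter> Q = {}" using disj P(3) by fastforce
    then show ?thesis
      using P finite card_Q by (simp add: card_Un_disjoint Q_def)
  qed
  ultimately have attained: "2 ^ (n - 2) + card B \<in> {card M | M. matching G M}"
    by (metis (mono_tags, lifting) mem_Collect_eq)
  \<comment> \<open>The bound also makes this set finite, as \<open>Max\<close> requires.\<close>
  have "{card M | M. matching G M} \<subseteq> {..2 ^ (n - 2) + card B}"
    using upper by blast
  then have "Max {card M | M. matching G M} = 2 ^ (n - 2) + card B"
    using attained by (intro Max_eqI) (blast intro: finite_subset)+
  moreover have "card (associate_class (gauss_int_mod n) (divisor_elt n n)) = 2 ^ (n - 1)"
    "card (associate_class (gauss_int_mod n) (divisor_elt n (n - 1))) = 2 ^ (n - 2)"
    using assms card_associate_class_divisor_elt[of n n] card_associate_class_divisor_elt[of "n - 1" n]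
    by (simp_all add: numeral_2_eq_2)
  \<comment> \<open>The subtraction in \<open>card B\<close> is truncated; it agrees with the
    integer one because \<open>2 ^ (n - 1)\<close> is at least 1.\<close>
  moreover have "int (2 ^ (n - 2) + (2 ^ (n - 1) - 1)) = 2 ^ (n - 1) + 2 ^ (n - 2) - 1"
  proof -
    have "(1::nat) \<le> 2 ^ (n - 1)" by simp
    then show ?thesis by (simp only: of_nat_add of_nat_diff of_nat_power of_nat_numeral of_nat_1)
  qed
  ultimately show ?thesis
    unfolding matching_number_def G_def card_B by simp
qed

end
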